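(* Let $n\ge1$, let $K_0\subset\cdots\subset K_n$ be a tower of subfields (equalities allowed) of a finite field $K=\mathbb{F}_q$, and let $\mathcal{X}=[K_0\times\cdots\times K_n]\subset\mathbb{P}^n$. Let $0\le j<n$, let $P=[e_j]$ and let $P'=\big[e_j+\sum_{i=j+1}^n a_ie_i\big]$ with $a_i\in K_i$ for $i=j+1,\ldots,n$ and $a_k\ne0$ for some $k$. Then the least degree of an indicator function for $P$ equals the least degree of an indicator function for $P'$, and $\mathrm{v}_P(I_{\mathcal X})=\mathrm{v}_{P'}(I_{\mathcal X})$.
   Context: $S=K[t_0,\ldots,t_n]=\bigoplus_{d\ge0}S_d$ has the standard grading, and $\mathbb{P}^n$ is projective space over $K$. $\mathcal{X}=[K_0\times\cdots\times K_n]:=\{(a_0:\cdots:a_n)\in\mathbb{P}^n: a_i\in K_i\text{ for all }i\}$. $e_0,\ldots,e_n$ is the canonical basis of $K^{n+1}$ and $[v]$ is the projective point defined by a nonzero vector $v$. An indicator function for $P\in\mathcal{X}$ is a homogeneous polynomial $f\in S$ with $f(P)\ne0$ and $f(Q)=0$ for all $Q\in\mathcal{X}\setminus\{P\}$. $I_{\mathcal X}\subset S$ is the ideal generated by the homogeneous polynomials vanishing at all points of $\mathcal{X}$, and $I_P$ is the same for the single point $P$. The local v-number is $\mathrm{v}_P(I_{\mathcal X}):=\min\{d\ge0:\exists f\in S_d\text{ with }(I_{\mathcal X}:f)=I_P\}$, where $(I_{\mathcal X}:f)=\{g\in S: gf\in I_{\mathcal X}\}$. *)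

theory Defs
  imports "HOL-Library.Poly_Mapping" "HOL-Algebra.Algebraic_Closure_Type"
begin

text \<open>
  Polynomials are finitely supported functions from monomials to coefficients, and monomials are
  finitely supported exponent functions on the variables \<open>t\<^sub>0, t\<^sub>1, \<dots>\<close>; multiplication is the
  convolution product of \<^theory>\<open>HOL-Library.Poly_Mapping\<close>.
\<close>

type_synonym 'k mpoly = "(nat \<Rightarrow>\<^sub>0 nat) \<Rightarrow>\<^sub>0 'k"

definition monom_deg :: "(nat \<Rightarrow>\<^sub>0 nat) \<Rightarrow> nat" where
  "monom_deg m = (\<Sum>i\<in>Poly_Mapping.keys m. Poly_Mapping.lookup m i)"

text \<open>\<open>K[t\<^sub>0, \<dots>, t\<^sub>n]\<close>, first as a set of polynomials, then as a ring.\<close>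

definition polys :: "nat \<Rightarrow> 'k::field mpoly set" where
  "polys n = {f. \<forall>m\<in>Poly_Mapping.keys f. Poly_Mapping.keys m \<subseteq> {..n}}"

definition poly_ring_upto :: "nat \<Rightarrow> 'k::field mpoly ring" where
  "poly_ring_upto n = ring_of_type_algebra\<lparr>carrier := polys n\<rparr>"

text \<open>The graded piece \<open>S\<^sub>d\<close>; it contains \<open>0\<close> for every \<open>d\<close>.\<close>

definition homog_polys :: "nat \<Rightarrow> nat \<Rightarrow> 'k::field mpoly set" where
  "homog_polys n d = {f \<in> polys n. \<forall>m\<in>Poly_Mapping.keys f. monom_deg m = d}"

definition eval_mpoly :: "'k::field mpoly \<Rightarrow> (nat \<Rightarrow> 'k) \<Rightarrow> 'k" where
  "eval_mpoly f v =
     (\<Sum>m\<in>Poly_Mapping.keys f.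
        Poly_Mapping.lookup f m * (\<Prod>i\<in>Poly_Mapping.keys m. v i ^ Poly_Mapping.lookup m i))"

text \<open>Vectors of \<open>K\<^sup>n\<^sup>+\<^sup>1\<close> are functions on the indices that vanish beyond \<open>n\<close>.\<close>

definition vectors :: "nat \<Rightarrow> (nat \<Rightarrow> 'k::field) set" where
  "vectors n = {v. \<forall>i>n. v i = 0}"

definition basis_vec :: "nat \<Rightarrow> nat \<Rightarrow> 'k::field" where
  "basis_vec j = (\<lambda>i. if i = j then 1 else 0)"

text \<open>The projective point of a nonzero vector is the set of its nonzero scalar multiples.\<close>

definition proj_point :: "(nat \<Rightarrow> 'k::field) \<Rightarrow> (nat \<Rightarrow> 'k) set" where
  "proj_point v = {(\<lambda>i. c * v i) | c. c \<noteq> 0}"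

definition proj_space :: "nat \<Rightarrow> (nat \<Rightarrow> 'k::field) set set" where
  "proj_space n = {proj_point v | v. v \<in> vectors n \<and> (\<exists>i\<le>n. v i \<noteq> 0)}"

text \<open>The set \<open>[K\<^sub>0 \<times> \<dots> \<times> K\<^sub>n]\<close>: some representative has its coordinates in the given sets.\<close>

definition proj_cartesian_set :: "nat \<Rightarrow> (nat \<Rightarrow> 'k::field set) \<Rightarrow> (nat \<Rightarrow> 'k) set set" where
  "proj_cartesian_set n Ks = {P \<in> proj_space n. \<exists>a\<in>P. \<forall>i\<le>n. a i \<in> Ks i}"

text \<open>
  Vanishing at a projective point. It is applied to homogeneous polynomials only, for which it does
  not depend on the representative.
\<close>

definition vanishes_at :: "'k::field mpoly \<Rightarrow> (nat \<Rightarrow> 'k) set \<Rightarrow> bool" where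
  "vanishes_at f P \<longleftrightarrow> (\<forall>v\<in>P. eval_mpoly f v = 0)"

definition indicator_poly ::
    "nat \<Rightarrow> (nat \<Rightarrow> 'k::field) set set \<Rightarrow> (nat \<Rightarrow> 'k) set \<Rightarrow> 'k mpoly \<Rightarrow> bool" where
  "indicator_poly n Xs P f \<longleftrightarrow>
     (\<exists>d. f \<in> homog_polys n d) \<and> \<not> vanishes_at f P \<and> (\<forall>Q\<in>Xs - {P}. vanishes_at f Q)"

text \<open>An indicator function is nonzero, so its degree is the unique \<open>d\<close> with \<open>f \<in> S\<^sub>d\<close>.\<close>

definition least_indicator_degree ::
    "nat \<Rightarrow> (nat \<Rightarrow> 'k::field) set set \<Rightarrow> (nat \<Rightarrow> 'k) set \<Rightarrow> nat" where
  "least_indicator_degree n Xs P = (LEAST d. \<exists>f\<in>homog_polys n d. indicator_poly n Xs P f)"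

definition vanishing_ideal :: "nat \<Rightarrow> (nat \<Rightarrow> 'k::field) set set \<Rightarrow> 'k mpoly set" where
  "vanishing_ideal n Xs =
     Idl\<^bsub>poly_ring_upto n\<^esub> {f. (\<exists>d. f \<in> homog_polys n d) \<and> (\<forall>Q\<in>Xs. vanishes_at f Q)}"

definition colon_ideal :: "nat \<Rightarrow> 'k::field mpoly set \<Rightarrow> 'k mpoly \<Rightarrow> 'k mpoly set" where
  "colon_ideal n I f = {g \<in> polys n. g * f \<in> I}"

definition local_v_number ::
    "nat \<Rightarrow> (nat \<Rightarrow> 'k::field) set set \<Rightarrow> (nat \<Rightarrow> 'k) set \<Rightarrow> nat" where
  "local_v_number n Xs P =
     (LEAST d. \<exists>f\<in>homog_polys n d. colon_ideal n (vanishing_ideal n Xs) f = vanishing_ideal n {P})"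

end

theory Submission
  imports Defs
begin

text \<open>
  The linear automorphism \<open>v \<mapsto> v + v\<^sub>j \<Sum>\<^sub>i\<^sub>>\<^sub>j a\<^sub>i e\<^sub>i\<close> of \<open>K\<^sup>n\<^sup>+\<^sup>1\<close> preserves \<open>K\<^sub>0 \<times> \<dots> \<times> K\<^sub>n\<close>,
  because \<open>K\<^sub>j \<subseteq> K\<^sub>i\<close> for \<open>i > j\<close>, and it maps \<open>e\<^sub>j\<close> to the representative of \<open>P'\<close>. The induced
  substitution \<open>t\<^sub>i \<mapsto> t\<^sub>i + a\<^sub>i t\<^sub>j\<close> is a degree-preserving automorphism of the polynomial ring, with
  inverse given by \<open>-a\<close>, so it carries indicator functions, vanishing ideals and colon ideals at
  \<open>P'\<close> to those at \<open>P\<close>.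
\<close>

section \<open>Substitution homomorphisms\<close>

text \<open>Formulated for type-class rings, so that the embedding of constants, evaluation at a
  vector and substitution of polynomials are all instances, although their domains and codomains are
  different types.\<close>

locale unital_ring_map =
  fixes h :: "'a::comm_ring_1 \<Rightarrow> 'b::comm_ring_1"
  assumes zero: "h 0 = 0" and one: "h 1 = 1"
    and add: "h (x + y) = h x + h y" and mult: "h (x * y) = h x * h y"
begin

lemma power: "h (x ^ k) = h x ^ k"
  by (induction k) (simp_all add: one mult)

lemma sum: "h (\<Sum>i\<in>A. f i) = (\<Sum>i\<in>A. h (f i))"
  by (induction A rule: infinite_finite_induct) (simp_all add: zero add)

lemma prod: "h (\<Prod>i\<in>A. f i) = (\<Prod>i\<in>A. h (f i))"
  by (induction A rule: infinite_finite_induct) (simp_all add: one mult)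

end

definition monom_val :: "(nat \<Rightarrow> 'r::comm_ring_1) \<Rightarrow> (nat \<Rightarrow>\<^sub>0 nat) \<Rightarrow> 'r" where
  "monom_val g m = (\<Prod>i\<in>Poly_Mapping.keys m. g i ^ Poly_Mapping.lookup m i)"

text \<open>When \<open>c\<close> is a ring map, this is the homomorphism given by the universal
  property of the polynomial ring, with \<open>g\<close> prescribing the images of the
  indeterminates. Evaluation takes the identity for \<open>c\<close>, substitution the embedding of
  constants.\<close>

definition insertion :: "('k::field \<Rightarrow> 'r::comm_ring_1) \<Rightarrow> (nat \<Rightarrow> 'r) \<Rightarrow> 'k mpoly \<Rightarrow> 'r" where
  "insertion c g f = (\<Sum>m\<in>Poly_Mapping.keys f. c (Poly_Mapping.lookup f m) * monom_val g m)"

text \<open>The additional factors are \<open>g i ^ 0 = 1\<close>. Monomials with different supports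
  can thus be compared over one index set.\<close>

lemma monom_val_superset:
  assumes "finite A" "Poly_Mapping.keys m \<subseteq> A"
  shows "monom_val g m = (\<Prod>i\<in>A. g i ^ Poly_Mapping.lookup m i)"
  unfolding monom_val_def using assms
  by (intro prod.mono_neutral_left) (auto simp: in_keys_iff)

lemma monom_val_0 [simp]: "monom_val g 0 = 1"
  by (simp add: monom_val_def)

lemma monom_val_single [simp]: "monom_val g (Poly_Mapping.single i k) = g i ^ k"
  by (simp add: monom_val_def)

lemma monom_val_add: "monom_val g (m + m') = monom_val g m * monom_val g m'"
proof -
  define A where "A = Poly_Mapping.keys m \<union> Poly_Mapping.keys m'"
  have A: "finite A" "Poly_Mapping.keys m \<subseteq> A" "Poly_Mapping.keys m' \<subseteq> A"
    "Poly_Mapping.keys (m + m') \<subseteq> A"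
    using keys_add[of m m'] by (auto simp: A_def)
  show ?thesis
    by (simp add: monom_val_superset[OF A(1,2)] monom_val_superset[OF A(1,3)]
        monom_val_superset[OF A(1,4)] lookup_add power_add prod.distrib)
qed

text \<open>Used at two levels: it splits a polynomial into its terms and, inside a monomial, the
  exponent function into single exponents.\<close>

lemma sum_monomials:
  "f = (\<Sum>m\<in>Poly_Mapping.keys f. Poly_Mapping.single m (Poly_Mapping.lookup f m))"
proof (rule poly_mapping_eqI)
  fix k
  show "Poly_Mapping.lookup f k = Poly_Mapping.lookup
      (\<Sum>m\<in>Poly_Mapping.keys f. Poly_Mapping.single m (Poly_Mapping.lookup f m)) k"
    by (simp add: lookup_sum lookup_single when_def not_in_keys_iff_lookup_eq_zero)
qed

lemma monom_val_indeterminates: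
  "monom_val (\<lambda>i. Poly_Mapping.single (Poly_Mapping.single i 1) 1) m
    = (Poly_Mapping.single m 1 :: 'k::field mpoly)"
proof -
  have pow: "(Poly_Mapping.single x (1::'k)) ^ k = Poly_Mapping.single (\<Sum>_<k. x) 1"
    for x :: "nat \<Rightarrow>\<^sub>0 nat" and k :: nat
    by (induction k) (simp_all add: mult_single distrib_right)
  have copies: "(\<Sum>_<k. Poly_Mapping.single i 1) = Poly_Mapping.single i k" for i k :: nat
    by (induction k) (simp_all del: sum_constant flip: single_add)
  have prod: "(\<Prod>i\<in>A. Poly_Mapping.single (x i) (1::'k)) = Poly_Mapping.single (\<Sum>i\<in>A. x i) 1"
    for A and x :: "nat \<Rightarrow> (nat \<Rightarrow>\<^sub>0 nat)"
    by (induction A rule: infinite_finite_induct) (simp_all add: mult_single)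
  show ?thesis
    unfolding monom_val_def pow copies prod by (simp flip: sum_monomials)
qed

lemma insertion_indeterminates:
  "insertion (Poly_Mapping.single 0) (\<lambda>i. Poly_Mapping.single (Poly_Mapping.single i 1) 1) f = f"
  unfolding insertion_def monom_val_indeterminates
  by (simp add: mult_single flip: sum_monomials)

context unital_ring_map
begin

lemma monom_val: "h (monom_val g m) = monom_val (\<lambda>i. h (g i)) m"
  by (simp add: monom_val_def prod power)

text \<open>A ring map applied after an insertion is again an insertion, determined by the images of
  constants and indeterminates. Both evaluating a sheared polynomial and composing two shears reduce
  to this.\<close>

lemma insertion: "h (insertion c g f) = insertion (\<lambda>x. h (c x)) (\<lambda>i. h (g i)) f"
  by (simp add: insertion_def sum mult monom_val)

end

text \<open>Additivity is checked over a common support, where missing coefficients contribute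
  \<open>c 0 = 0\<close>. Multiplicativity follows by expanding both factors into terms, since
  \<open>monom_val\<close> turns sums of exponents into products.\<close>

lemma unital_ring_map_insertion:
  fixes c :: "'k::field \<Rightarrow> 'r::comm_ring_1"
  assumes "unital_ring_map c"
  shows "unital_ring_map (insertion c g)"
proof -
  interpret c: unital_ring_map c by fact
  have superset: "insertion c g f = (\<Sum>m\<in>A. c (Poly_Mapping.lookup f m) * monom_val g m)"
    if "finite A" "Poly_Mapping.keys f \<subseteq> A" for f A
    unfolding insertion_def using that
    by (intro sum.mono_neutral_left) (auto simp: in_keys_iff c.zero)
  have ins_add: "insertion c g (p + q) = insertion c g p + insertion c g q" for p q
  proof -
    define A where "A = Poly_Mapping.keys p \<union> Poly_Mapping.keys q"
    have A: "finite A" "Poly_Mapping.keys p \<subseteq> A" "Poly_Mapping.keys q \<subseteq> A"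
      "Poly_Mapping.keys (p + q) \<subseteq> A"
      using keys_add[of p q] by (auto simp: A_def)
    show ?thesis
      by (simp add: superset[OF A(1,2)] superset[OF A(1,3)] superset[OF A(1,4)]
          lookup_add c.add distrib_right sum.distrib)
  qed
  have ins_zero: "insertion c g 0 = 0" by (simp add: insertion_def)
  have ins_single: "insertion c g (Poly_Mapping.single m x) = c x * monom_val g m" for m x
    by (simp add: insertion_def c.zero)
  have ins_sum: "insertion c g (\<Sum>i\<in>A. p i) = (\<Sum>i\<in>A. insertion c g (p i))"
    for A and p :: "(nat \<Rightarrow>\<^sub>0 nat) \<Rightarrow> 'k mpoly"
    by (induction A rule: infinite_finite_induct) (simp_all add: ins_zero ins_add)
  have ins_mult: "insertion c g (p * q) = insertion c g p * insertion c g q" for p q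
  proof -
    have "p * q = (\<Sum>m\<in>Poly_Mapping.keys p. Poly_Mapping.single m (Poly_Mapping.lookup p m)) *
        (\<Sum>m\<in>Poly_Mapping.keys q. Poly_Mapping.single m (Poly_Mapping.lookup q m))"
      by (simp flip: sum_monomials)
    also have "insertion c g \<dots> = insertion c g p * insertion c g q"
      unfolding sum_product ins_sum mult_single ins_single c.mult monom_val_add
      unfolding insertion_def sum_product by (simp add: mult_ac)
    finally show ?thesis .
  qed
  show ?thesis
    by unfold_locales
      (simp_all add: ins_zero ins_add ins_mult c.one ins_single flip: single_one)
qed

lemma unital_ring_map_ident: "unital_ring_map (\<lambda>x. x)"
  by unfold_locales simp_all

lemma unital_ring_map_const: "unital_ring_map (Poly_Mapping.single 0 :: 'k::field \<Rightarrow> 'k mpoly)"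
  by unfold_locales (simp_all add: single_add mult_single)

lemma eval_mpoly_eq_insertion: "eval_mpoly f v = insertion (\<lambda>x. x) v f"
  by (simp add: eval_mpoly_def insertion_def monom_val_def)

section \<open>The graded polynomial ring\<close>

lemma monom_deg_add: "monom_deg (m + m') = monom_deg m + monom_deg m'"
proof -
  define A where "A = Poly_Mapping.keys m \<union> Poly_Mapping.keys m'"
  have deg: "monom_deg x = (\<Sum>i\<in>A. Poly_Mapping.lookup x i)" if "Poly_Mapping.keys x \<subseteq> A" for x
    unfolding monom_deg_def using that
    by (intro sum.mono_neutral_left) (auto simp: A_def in_keys_iff)
  show ?thesis
    using keys_add[of m m'] by (simp add: deg A_def lookup_add sum.distrib)
qed

lemma monom_deg_0 [simp]: "monom_deg 0 = 0"
  by (simp add: monom_deg_def)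

lemma monom_deg_single [simp]: "monom_deg (Poly_Mapping.single i k) = k"
  by (simp add: monom_deg_def)

lemma polys_0 [simp]: "0 \<in> polys n" and polys_1 [simp]: "1 \<in> polys n"
  by (simp_all add: polys_def)

lemma polys_add: "p \<in> polys n \<Longrightarrow> q \<in> polys n \<Longrightarrow> p + q \<in> polys n"
  using keys_add[of p q] unfolding polys_def by blast

lemma polys_uminus: "p \<in> polys n \<Longrightarrow> - p \<in> polys n"
  by (auto simp: polys_def in_keys_iff)

lemma polys_mult:
  assumes "p \<in> polys n" "q \<in> polys n"
  shows "p * q \<in> polys n"
  unfolding polys_def
proof safe
  fix m i assume "m \<in> Poly_Mapping.keys (p * q)" "i \<in> Poly_Mapping.keys m"
  then obtain a b where ab: "m = a + b" "a \<in> Poly_Mapping.keys p" "b \<in> Poly_Mapping.keys q"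
    using keys_mult[of p q] by blast
  have "i \<in> Poly_Mapping.keys a \<union> Poly_Mapping.keys b"
    using \<open>i \<in> Poly_Mapping.keys m\<close> keys_add[of a b] ab(1) by blast
  then show "i \<le> n" using assms ab by (auto simp: polys_def)
qed

lemma homog_polys_subset: "homog_polys n d \<subseteq> polys n"
  by (auto simp: homog_polys_def)

lemma homog_polys_mult:
  assumes "p \<in> homog_polys n d" "q \<in> homog_polys n e"
  shows "p * q \<in> homog_polys n (d + e)"
proof -
  have "p * q \<in> polys n" using assms homog_polys_subset by (blast intro: polys_mult)
  moreover have "monom_deg m = d + e" if "m \<in> Poly_Mapping.keys (p * q)" for m
    using keys_mult[of p q] that assms by (fastforce simp: homog_polys_def monom_deg_add)
  ultimately show ?thesis by (simp add: homog_polys_def)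
qed

lemma homog_polys_add: "p \<in> homog_polys n d \<Longrightarrow> q \<in> homog_polys n d \<Longrightarrow> p + q \<in> homog_polys n d"
  using keys_add[of p q] polys_add[of p n q] unfolding homog_polys_def by blast

lemma homog_polys_0: "0 \<in> homog_polys n d"
  by (simp add: homog_polys_def)

lemma homog_polys_1: "1 \<in> homog_polys n 0"
  by (simp add: homog_polys_def)

lemma homog_polys_const: "Poly_Mapping.single 0 c \<in> homog_polys n 0"
  by (simp add: homog_polys_def polys_def)

lemma homog_polys_indeterminate:
  "i \<le> n \<Longrightarrow> Poly_Mapping.single (Poly_Mapping.single i 1) 1 \<in> homog_polys n 1"
  by (simp add: homog_polys_def polys_def)

lemma homog_polys_power: "p \<in> homog_polys n 1 \<Longrightarrow> p ^ k \<in> homog_polys n k"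
  using homog_polys_mult[of p n 1] by (induction k) (simp_all add: homog_polys_1)

lemma homog_polys_monom_val:
  assumes g: "\<And>i. i \<le> n \<Longrightarrow> g i \<in> homog_polys n 1" and m: "Poly_Mapping.keys m \<subseteq> {..n}"
  shows "monom_val g m \<in> homog_polys n (monom_deg m)"
proof -
  have "(\<Prod>i\<in>A. g i ^ Poly_Mapping.lookup m i)
      \<in> homog_polys n (\<Sum>i\<in>A. Poly_Mapping.lookup m i)" if "finite A" "A \<subseteq> {..n}" for A
    using that
    by (induction A rule: finite_induct)
      (use g in \<open>auto simp: homog_polys_1 intro!: homog_polys_mult homog_polys_power\<close>)
  then show ?thesis using m by (simp add: monom_val_def monom_deg_def)
qed

text \<open>Each term of \<open>f\<close> becomes a constant times a product of \<open>d\<close>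
  linear forms.\<close>

lemma homog_polys_insertion:
  assumes g: "\<And>i. i \<le> n \<Longrightarrow> g i \<in> homog_polys n 1" and f: "f \<in> homog_polys n d"
  shows "insertion (Poly_Mapping.single 0) g f \<in> homog_polys n d"
proof -
  have "(\<Sum>m\<in>A. Poly_Mapping.single 0 (Poly_Mapping.lookup f m) * monom_val g m)
      \<in> homog_polys n d" if "finite A" "A \<subseteq> Poly_Mapping.keys f" for A
    using that
  proof (induction A rule: finite_induct)
    case (insert m A)
    have "Poly_Mapping.keys m \<subseteq> {..n}" "monom_deg m = d"
      using f insert.prems by (auto simp: homog_polys_def polys_def)
    then have "Poly_Mapping.single 0 (Poly_Mapping.lookup f m) * monom_val g m \<in> homog_polys n d"
      using homog_polys_mult[OF homog_polys_const homog_polys_monom_val[OF g]] by fastforce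
    with insert show ?case by (simp add: homog_polys_add)
  qed (simp add: homog_polys_0)
  then show ?thesis by (simp add: insertion_def)
qed

lemma polys_insertion:
  assumes g: "\<And>i. i \<le> n \<Longrightarrow> g i \<in> homog_polys n 1" and f: "f \<in> polys n"
  shows "insertion (Poly_Mapping.single 0) g f \<in> polys n"
proof -
  have "(\<Sum>m\<in>A. Poly_Mapping.single 0 (Poly_Mapping.lookup f m) * monom_val g m)
      \<in> polys n" if "finite A" "A \<subseteq> Poly_Mapping.keys f" for A
    using that
  proof (induction A rule: finite_induct)
    case (insert m A)
    have "Poly_Mapping.keys m \<subseteq> {..n}"
      using f insert.prems by (auto simp: polys_def)
    then have "monom_val g m \<in> polys n"
      using homog_polys_monom_val[of n g m] g homog_polys_subset by blast
    then have "Poly_Mapping.single 0 (Poly_Mapping.lookup f m) * monom_val g m \<in> polys n"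
      using homog_polys_const homog_polys_subset by (blast intro: polys_mult)
    with insert show ?case by (simp add: polys_add)
  qed simp
  then show ?thesis by (simp add: insertion_def)
qed

text \<open>Vanishing ideals are generated ideals in the sense of HOL-Algebra, so this ring
  structure gives access to \<open>genideal_minimal\<close> and its companions. It is inherited from
  the ring of all polynomials, in which \<open>polys n\<close> is a subring.\<close>

lemma ring_poly_ring_upto: "ring (poly_ring_upto n :: 'k::field mpoly ring)"
proof -
  interpret R: ring "ring_of_type_algebra :: 'k mpoly ring"
    by (rule ring_from_type_algebra)
  have minus: "\<ominus>\<^bsub>ring_of_type_algebra\<^esub> p = - p" for p :: "'k mpoly"
    by (rule R.minus_equality) (simp_all add: ring_of_type_algebra_def)
  have "subring (polys n) (ring_of_type_algebra :: 'k mpoly ring)"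
    by (rule R.subringI)
      (simp_all add: minus polys_uminus,
       simp_all add: ring_of_type_algebra_def polys_mult polys_add)
  then show ?thesis
    unfolding poly_ring_upto_def by (rule R.subring_is_ring)
qed

section \<open>Shears\<close>

definition shear :: "nat \<Rightarrow> (nat \<Rightarrow> 'k::field) \<Rightarrow> (nat \<Rightarrow> 'k) \<Rightarrow> nat \<Rightarrow> 'k" where
  "shear j b v = (\<lambda>i. v i + b i * v j)"

text \<open>Pullback of polynomials along \<open>shear j b\<close>; it therefore transports data at
  the image of a point back to the point itself.\<close>

definition shear_poly :: "nat \<Rightarrow> (nat \<Rightarrow> 'k::field) \<Rightarrow> 'k mpoly \<Rightarrow> 'k mpoly" where
  "shear_poly j b = insertion (Poly_Mapping.single 0)
     (\<lambda>i. Poly_Mapping.single (Poly_Mapping.single i 1) 1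
        + Poly_Mapping.single (Poly_Mapping.single j 1) (b i))"

lemma unital_ring_map_shear_poly: "unital_ring_map (shear_poly j b)"
  unfolding shear_poly_def by (rule unital_ring_map_insertion[OF unital_ring_map_const])

text \<open>Substitution followed by evaluation at \<open>v\<close> is an insertion sending the
  indeterminate \<open>i\<close> to \<open>v i + b i * v j\<close>.\<close>

lemma eval_shear_poly: "eval_mpoly (shear_poly j b f) v = eval_mpoly f (shear j b v)"
proof -
  interpret h: unital_ring_map "insertion (\<lambda>x. x) v"
    by (rule unital_ring_map_insertion[OF unital_ring_map_ident])
  have single: "insertion (\<lambda>x. x) v (Poly_Mapping.single m x) = x * monom_val v m" for m x
    by (simp add: insertion_def)
  show ?thesis
    unfolding eval_mpoly_eq_insertion shear_poly_def h.insertion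
    by (simp add: h.add single shear_def)
qed

text \<open>Since \<open>b j = 0\<close>, the outer substitution fixes the indeterminate
  \<open>j\<close>, so on every indeterminate the two added multiples of it cancel. The composite is
  then the identity by \<open>insertion_indeterminates\<close>.\<close>

lemma shear_poly_inverse:
  assumes "b j = 0"
  shows "shear_poly j (\<lambda>i. - b i) (shear_poly j b f) = f"
proof -
  interpret h: unital_ring_map "shear_poly j (\<lambda>i. - b i)"
    by (rule unital_ring_map_shear_poly)
  have single: "shear_poly j (\<lambda>i. - b i) (Poly_Mapping.single m x) = Poly_Mapping.single 0 x *
      monom_val (\<lambda>i. Poly_Mapping.single (Poly_Mapping.single i 1) 1 +
        Poly_Mapping.single (Poly_Mapping.single j 1) (- b i)) m" for m x
    by (simp add: shear_poly_def insertion_def)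
  show ?thesis
    unfolding shear_poly_def[of j b] h.insertion
    using insertion_indeterminates[of f]
    by (simp add: h.add single assms mult_single add.assoc flip: single_add)
qed

lemma shear_inverse: "b j = 0 \<Longrightarrow> shear j (\<lambda>i. - b i) (shear j b v) = v"
  by (simp add: shear_def)

lemma shear_poly_homog_polys:
  assumes "j \<le> n" "f \<in> homog_polys n d"
  shows "shear_poly j b f \<in> homog_polys n d"
  unfolding shear_poly_def using assms
  by (intro homog_polys_insertion homog_polys_add homog_polys_indeterminate)
    (simp_all add: homog_polys_def polys_def)

lemma shear_poly_polys:
  assumes "j \<le> n" "f \<in> polys n"
  shows "shear_poly j b f \<in> polys n"
  unfolding shear_poly_def using assms
  by (intro polys_insertion homog_polys_add homog_polys_indeterminate)
    (simp_all add: homog_polys_def polys_def)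

section \<open>Transport of vanishing, indicator functions and ideals along shears\<close>

lemma vanishes_at_shear_poly: "vanishes_at (shear_poly j b f) Q \<longleftrightarrow> vanishes_at f (shear j b ` Q)"
  by (simp add: vanishes_at_def eval_shear_poly)

lemma shear_proj_point: "shear j b ` proj_point v = proj_point (shear j b v)"
proof -
  have "shear j b (\<lambda>i. c * v i) = (\<lambda>i. c * shear j b v i)" for c
    by (simp add: shear_def algebra_simps)
  then show ?thesis by (auto simp: proj_point_def image_iff) metis
qed

text \<open>It suffices to treat the homogeneous generators: their pullbacks keep the degree and
  vanish on \<open>Ys\<close>, because the shear maps \<open>Ys\<close> into \<open>Zs\<close>. The
  preimage of an ideal under a ring homomorphism is an ideal, so once it contains the generators it
  contains the ideal they generate.\<close>

lemma shear_poly_vanishing_ideal: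
  assumes "j \<le> n" and img: "\<And>Q. Q \<in> Ys \<Longrightarrow> shear j b ` Q \<in> Zs"
    and f: "f \<in> vanishing_ideal n Zs"
  shows "shear_poly j b f \<in> vanishing_ideal n Ys"
proof -
  let ?R = "poly_ring_upto n :: 'a mpoly ring"
  let ?G = "\<lambda>Xs. {f :: 'a mpoly. (\<exists>d. f \<in> homog_polys n d) \<and> (\<forall>Q\<in>Xs. vanishes_at f Q)}"
  interpret R: ring ?R by (rule ring_poly_ring_upto)
  interpret h: unital_ring_map "shear_poly j b" by (rule unital_ring_map_shear_poly)
  interpret hom: ring_hom_ring ?R ?R "shear_poly j b"
    by (rule ring_hom_ringI2[OF R.ring_axioms R.ring_axioms], rule ring_hom_memI)
      (simp_all add: poly_ring_upto_def ring_of_type_algebra_def shear_poly_polys \<open>j \<le> n\<close>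
        h.add h.mult h.one)
  have carr: "carrier ?R = polys n" by (simp add: poly_ring_upto_def)
  have G: "?G Xs \<subseteq> carrier ?R" for Xs
    using homog_polys_subset unfolding carr by blast
  have ideal: "ideal (vanishing_ideal n Xs) ?R" for Xs
    unfolding vanishing_ideal_def by (rule R.genideal_ideal[OF G])
  have gen: "?G Xs \<subseteq> vanishing_ideal n Xs" for Xs
    unfolding vanishing_ideal_def by (rule R.genideal_self[OF G])
  let ?J = "{r \<in> carrier ?R. shear_poly j b r \<in> vanishing_ideal n Ys}"
  have "ideal ?J ?R"
    by (rule hom.ideal_vimage) (rule ideal)
  moreover have "?G Zs \<subseteq> ?J"
  proof
    fix p assume p: "p \<in> ?G Zs"
    then have "shear_poly j b p \<in> ?G Ys"
      using img shear_poly_homog_polys[OF \<open>j \<le> n\<close>] by (fastforce simp: vanishes_at_shear_poly)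
    then show "p \<in> ?J" using gen G p by blast
  qed
  ultimately have "vanishing_ideal n Zs \<subseteq> ?J"
    unfolding vanishing_ideal_def[of n Zs] by (rule R.genideal_minimal)
  then show ?thesis using f by blast
qed

text \<open>The shear is injective, so a point of \<open>Xs\<close> other than \<open>P\<close> goes
  to a point of \<open>Xs\<close> other than the image of \<open>P\<close>, where \<open>f\<close>
  vanishes.\<close>

lemma indicator_poly_shear_poly:
  assumes j: "j \<le> n" "b j = 0" and inv: "\<And>Q. Q \<in> Xs \<Longrightarrow> shear j b ` Q \<in> Xs"
    and f: "indicator_poly n Xs (shear j b ` P) f"
  shows "indicator_poly n Xs P (shear_poly j b f)"
  unfolding indicator_poly_def vanishes_at_shear_poly
proof (intro conjI ballI)
  show "\<exists>d. shear_poly j b f \<in> homog_polys n d"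
    using f shear_poly_homog_polys[OF j(1)] by (auto simp: indicator_poly_def)
  show "\<not> vanishes_at f (shear j b ` P)"
    using f by (simp add: indicator_poly_def)
  have "inj (shear j b)"
    using shear_inverse[of b j, OF j(2)] by (metis injI)
  then show "vanishes_at f (shear j b ` Q)" if "Q \<in> Xs - {P}" for Q
    using f inv that by (auto simp: indicator_poly_def inj_image_eq_iff)
qed

text \<open>The pullback is a ring automorphism that preserves the ideal of \<open>Xs\<close> and
  carries the ideal of the sheared point onto that of \<open>P\<close>, so it also carries the colon
  ideal of \<open>f\<close> onto that of its pullback.\<close>

lemma colon_ideal_shear_poly:
  assumes j: "j \<le> n" "b j = 0"
    and inv: "\<And>Q. Q \<in> Xs \<Longrightarrow> shear j b ` Q \<in> Xs"
      "\<And>Q. Q \<in> Xs \<Longrightarrow> shear j (\<lambda>i. - b i) ` Q \<in> Xs"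
    and f: "colon_ideal n (vanishing_ideal n Xs) f = vanishing_ideal n {shear j b ` P}"
  shows "colon_ideal n (vanishing_ideal n Xs) (shear_poly j b f) = vanishing_ideal n {P}"
proof -
  let ?s = "shear_poly j b" and ?s' = "shear_poly j (\<lambda>i. - b i)"
  interpret s: unital_ring_map ?s by (rule unital_ring_map_shear_poly)
  interpret s': unital_ring_map ?s' by (rule unital_ring_map_shear_poly)
  have s's: "?s' (?s p) = p" for p by (rule shear_poly_inverse[of b j, OF j(2)])
  have ss': "?s (?s' p) = p" for p
    using shear_poly_inverse[of "\<lambda>i. - b i" j p] j(2) by simp
  \<comment> \<open>The converse direction applies the pullback along \<open>- b\<close> to
    \<open>?s p\<close>, which returns \<open>p\<close>.\<close>
  have X: "?s p \<in> vanishing_ideal n Xs \<longleftrightarrow> p \<in> vanishing_ideal n Xs" for p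
    using shear_poly_vanishing_ideal[OF j(1) inv(1), of Xs p]
      shear_poly_vanishing_ideal[OF j(1) inv(2), of Xs "?s p"] s's by metis
  have unshear: "shear j (\<lambda>i. - b i) ` shear j b ` P = P"
    by (simp add: image_image shear_inverse[of b j, OF j(2)])
  have P: "?s p \<in> vanishing_ideal n {P} \<longleftrightarrow> p \<in> vanishing_ideal n {shear j b ` P}" for p
  proof
    assume "?s p \<in> vanishing_ideal n {P}"
    then have "?s' (?s p) \<in> vanishing_ideal n {shear j b ` P}"
      by (rule shear_poly_vanishing_ideal[OF j(1), rotated]) (simp add: unshear)
    then show "p \<in> vanishing_ideal n {shear j b ` P}" by (simp add: s's)
  qed (rule shear_poly_vanishing_ideal[OF j(1)], simp_all)
  have "g \<in> colon_ideal n (vanishing_ideal n Xs) (?s f) \<longleftrightarrow> g \<in> vanishing_ideal n {P}" for g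
  proof -
    have "g \<in> polys n \<longleftrightarrow> ?s' g \<in> polys n"
      using shear_poly_polys[OF j(1)] ss' by metis
    \<comment> \<open>Writing \<open>g\<close> as \<open>?s (?s' g)\<close> moves the whole product
      under the automorphism.\<close>
    moreover have "g * ?s f = ?s (?s' g * f)" by (simp add: s.mult ss')
    ultimately have "g \<in> colon_ideal n (vanishing_ideal n Xs) (?s f) \<longleftrightarrow>
        ?s' g \<in> colon_ideal n (vanishing_ideal n Xs) f"
      by (simp add: colon_ideal_def X)
    also have "\<dots> \<longleftrightarrow> g \<in> vanishing_ideal n {P}"
      using P[of "?s' g"] by (simp add: f ss')
    finally show ?thesis .
  qed
  then show ?thesis by blast
qed

text \<open>Pulling back along \<open>b\<close> and along \<open>- b\<close> shows that both points
  have the same attainable degrees. Each pair of \<open>LEAST\<close> expressions then agrees,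
  without any appeal to existence.\<close>

lemma degrees_shear:
  assumes j: "j \<le> n" "b j = 0"
    and inv: "\<And>Q. Q \<in> Xs \<Longrightarrow> shear j b ` Q \<in> Xs"
      "\<And>Q. Q \<in> Xs \<Longrightarrow> shear j (\<lambda>i. - b i) ` Q \<in> Xs"
  shows "least_indicator_degree n Xs (shear j b ` P) = least_indicator_degree n Xs P"
    and "local_v_number n Xs (shear j b ` P) = local_v_number n Xs P"
proof -
  have unshear: "shear j (\<lambda>i. - b i) ` shear j b ` P = P"
    by (simp add: image_image shear_inverse[of b j, OF j(2)])
  have "(\<exists>f\<in>homog_polys n d. indicator_poly n Xs (shear j b ` P) f) \<longleftrightarrow>
      (\<exists>f\<in>homog_polys n d. indicator_poly n Xs P f)" for d
    using indicator_poly_shear_poly[of j n b Xs P, OF j inv(1)]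
      indicator_poly_shear_poly[of j n "\<lambda>i. - b i" Xs "shear j b ` P", OF j(1) _ inv(2)]
      shear_poly_homog_polys[OF j(1)] j(2) unfolding unshear by (metis neg_equal_0_iff_equal)
  then show "least_indicator_degree n Xs (shear j b ` P) = least_indicator_degree n Xs P"
    by (simp add: least_indicator_degree_def)
  have "(\<exists>f\<in>homog_polys n d. colon_ideal n (vanishing_ideal n Xs) f
        = vanishing_ideal n {shear j b ` P}) \<longleftrightarrow>
      (\<exists>f\<in>homog_polys n d. colon_ideal n (vanishing_ideal n Xs) f = vanishing_ideal n {P})" for d
  proof -
    have "colon_ideal n (vanishing_ideal n Xs) (shear_poly j (\<lambda>i. - b i) f)
        = vanishing_ideal n {shear j b ` P}"
      if "colon_ideal n (vanishing_ideal n Xs) f = vanishing_ideal n {P}" for f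
      using colon_ideal_shear_poly[of j n "\<lambda>i. - b i" Xs f "shear j b ` P", OF j(1) _ inv(2)]
        inv(1) j(2) that by (simp add: unshear)
    then show ?thesis
      using colon_ideal_shear_poly[of j n b Xs _ P, OF j inv] shear_poly_homog_polys[OF j(1)]
      by blast
  qed
  then show "local_v_number n Xs (shear j b ` P) = local_v_number n Xs P"
    by (simp add: local_v_number_def)
qed

section \<open>Invariance of the projective Cartesian set, and the shear from \<open>P\<close> to
  \<open>P'\<close>\<close>

lemma shear_proj_cartesian_set:
  assumes j: "j \<le> n" "b j = 0" and b: "\<And>i. i > n \<Longrightarrow> b i = 0"
    and K: "\<And>i x y. i \<le> n \<Longrightarrow> x \<in> Ks i \<Longrightarrow> y \<in> Ks j \<Longrightarrow> x + b i * y \<in> Ks i"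
    and Q: "Q \<in> proj_cartesian_set n Ks"
  shows "shear j b ` Q \<in> proj_cartesian_set n Ks"
proof -
  obtain v a where v: "Q = proj_point v" "v \<in> vectors n" "\<exists>i\<le>n. v i \<noteq> 0"
    and a: "a \<in> Q" "\<forall>i\<le>n. a i \<in> Ks i"
    using Q by (auto simp: proj_cartesian_set_def proj_space_def)
  have "shear j b v \<in> vectors n"
    using v(2) b by (simp add: vectors_def shear_def)
  \<comment> \<open>If \<open>v j = 0\<close> the shear fixes \<open>v\<close>; otherwise coordinate
    \<open>j\<close> remains nonzero because \<open>b j = 0\<close>.\<close>
  moreover have "\<exists>i\<le>n. shear j b v i \<noteq> 0"
    using v(3) j by (cases "v j = 0") (auto simp: shear_def)
  ultimately have "shear j b ` Q \<in> proj_space n"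
    unfolding proj_space_def v(1) shear_proj_point by blast
  \<comment> \<open>Membership is witnessed by shearing the representative \<open>a\<close> with
    coordinates in the sets \<open>Ks i\<close>, not the arbitrary representative
    \<open>v\<close>.\<close>
  moreover have "\<forall>i\<le>n. shear j b a i \<in> Ks i"
    using a(2) K j(1) by (simp add: shear_def)
  ultimately show ?thesis
    using a(1) by (auto simp: proj_cartesian_set_def)
qed

theorem theorem4p3:
  fixes Ks :: "nat \<Rightarrow> 'k::{field, finite} set"
    and a :: "nat \<Rightarrow> 'k"
    and n j :: nat
  assumes "n \<ge> 1"
    and "\<And>i. i \<le> n \<Longrightarrow> subfield (Ks i) (ring_of_type_algebra :: 'k ring)"
    and "\<And>i. i < n \<Longrightarrow> Ks i \<subseteq> Ks (Suc i)"
    and "j < n"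
    and "\<And>i. i \<in> {j+1..n} \<Longrightarrow> a i \<in> Ks i"
    and "\<exists>k\<in>{j+1..n}. a k \<noteq> 0"
  defines "Xs \<equiv> proj_cartesian_set n Ks"
    and "P \<equiv> proj_point (basis_vec j)"
    and "P' \<equiv> proj_point (\<lambda>l. basis_vec j l + (\<Sum>i=j+1..n. a i * basis_vec i l))"
  shows "least_indicator_degree n Xs P = least_indicator_degree n Xs P'
    \<and> local_v_number n Xs P = local_v_number n Xs P'"
proof -
  interpret R: ring "ring_of_type_algebra :: 'k ring" by (rule ring_from_type_algebra)
  have minus: "\<ominus>\<^bsub>ring_of_type_algebra\<^esub> x = - x" for x :: 'k
    by (rule R.minus_equality) (simp_all add: ring_of_type_algebra_def)
  have K: "x + y \<in> Ks i" "x * y \<in> Ks i" "- x \<in> Ks i" if "i \<le> n" "x \<in> Ks i" "y \<in> Ks i" for x y i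
  proof -
    have "subring (Ks i) (ring_of_type_algebra :: 'k ring)"
      using assms(2)[OF that(1)] by (simp add: subfieldE(1))
    from subringE(5,6,7)[OF this] that minus
    show "x + y \<in> Ks i" "x * y \<in> Ks i" "- x \<in> Ks i"
      by (simp_all add: ring_of_type_algebra_def)
  qed
  have mono: "Ks j \<subseteq> Ks i" if "j \<le> i" "i \<le> n" for i
    using that by (induction i rule: dec_induct) (use assms(3) Suc_le_lessD in \<open>blast dest: Suc_leD\<close>)+
  \<comment> \<open>\<open>a\<close> is unconstrained outside \<open>{j+1..n}\<close>. The value 0
    at \<open>j\<close> makes the shear invertible, and the value 0 beyond \<open>n\<close> keeps it
    inside \<open>vectors n\<close>.\<close>
  define b where "b i = (if i \<in> {j+1..n} then a i else 0)" for i
  have b0: "b j = 0" "\<And>i. i > n \<Longrightarrow> b i = 0" by (simp_all add: b_def)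
  \<comment> \<open>Both signs are treated because the inverse shear must preserve \<open>Xs\<close>
    as well.\<close>
  have closed: "x + b i * y \<in> Ks i" "x + - b i * y \<in> Ks i"
    if "i \<le> n" "x \<in> Ks i" "y \<in> Ks j" for i x y
  proof -
    \<comment> \<open>The tower enters here: \<open>y\<close> lies in \<open>Ks j\<close>, hence in
      \<open>Ks i\<close>, where it can be multiplied by \<open>a i\<close>.\<close>
    have "a i * y \<in> Ks i \<and> - a i * y \<in> Ks i" if "i \<in> {j+1..n}"
      using K that mono[of i] assms(5)[OF that] \<open>y \<in> Ks j\<close> by auto
    then show "x + b i * y \<in> Ks i" "x + - b i * y \<in> Ks i"
      using K(1)[of i x "a i * y"] K(1)[of i x "- a i * y"] that by (auto simp: b_def)
  qed
  have inv: "shear j b ` Q \<in> Xs" "shear j (\<lambda>i. - b i) ` Q \<in> Xs" if "Q \<in> Xs" for Q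
    using that closed b0 assms(4) unfolding Xs_def
    by (auto intro!: shear_proj_cartesian_set)
  \<comment> \<open>In this form the sum over \<open>i\<close> collapses to its term at
    \<open>l\<close>, which is \<open>b l\<close>.\<close>
  have "a i * basis_vec i l = (if l = i then a i else 0)" for i l
    by (simp add: basis_vec_def)
  then have "shear j b (basis_vec j) = (\<lambda>l. basis_vec j l + (\<Sum>i=j+1..n. a i * basis_vec i l))"
    by (simp add: shear_def b_def) (simp add: basis_vec_def)
  then have "P' = shear j b ` P"
    by (simp add: P_def P'_def shear_proj_point)
  then show ?thesis
    using degrees_shear[of j n b Xs P] inv b0(1) assms(4) by simp
qed

end
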